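(* For each integer $n \geq 1$ there exists a set $S_n \subset C_n(1)$ of cardinality $n+2$ which cannot be covered by fewer than $3$ parallel hyperplanes.
   Context: $C_n(1) = \{ \boldsymbol{x} \in \mathbb{Z}^n : |\boldsymbol{x}| \leq 1 \}$, where $|\boldsymbol{x}| = \max_i |x_i|$ is the sup-norm; thus $C_n(1) = \{0, \pm 1\}^n$. A hyperplane in $\mathbb{R}^n$ is an affine subspace of dimension $n-1$; "cannot be covered by fewer than $N$ parallel hyperplanes" means that no collection of fewer than $N$ pairwise parallel hyperplanes in $\mathbb{R}^n$ has union containing the set. *)

theory Defs
  imports "HOL-Analysis.Analysis"
begin

text \<open>Real \<open>n\<close>-space is \<^typ>\<open>real ^ 'n\<close> with \<open>n = CARD('n) \<ge> 1\<close>.\<close>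

definition integer_cube :: "real \<Rightarrow> (real ^ 'n) set" where
  "integer_cube T = {x. (\<forall>i. x $ i \<in> \<int>) \<and> infnorm x \<le> T}"

definition hyperplane :: "(real ^ 'n) set \<Rightarrow> bool" where
  "hyperplane H \<longleftrightarrow> affine H \<and> aff_dim H = int CARD('n) - 1"

definition covered_by_parallel_hyperplanes :: "(real ^ 'n) set \<Rightarrow> (real ^ 'n) set set \<Rightarrow> bool" where
  "covered_by_parallel_hyperplanes S \<H> \<longleftrightarrow>
     (\<forall>H\<in>\<H>. hyperplane H) \<and> pairwise affine_parallel \<H> \<and> S \<subseteq> \<Union>\<H>"

definition not_covered_by_fewer_than :: "nat \<Rightarrow> (real ^ 'n) set \<Rightarrow> bool" where
  "not_covered_by_fewer_than N S \<longleftrightarrow>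
     \<not> (\<exists>\<H>. finite \<H> \<and> card \<H> < N \<and> covered_by_parallel_hyperplanes S \<H>)"

end

theory Submission
  imports Defs
begin

text \<open>
  Take the origin together with the vertices \<open>e\<^sub>1, \<dots>, e\<^sub>n, -(e\<^sub>1 + \<dots> + e\<^sub>n)\<close> of a simplex around it.
  If two parallel hyperplanes with normal \<open>a \<noteq> 0\<close> covered these points, then \<open>x \<mapsto> a \<bullet> x\<close> would
  take only the values \<open>0\<close> and some \<open>c\<close> on them. Hence \<open>k\<close> of the coordinates of \<open>a\<close> equal \<open>c \<noteq> 0\<close>,
  the others vanish, and \<open>-k c \<in> {0, c}\<close>. This forces \<open>k = 0\<close>, so \<open>a = 0\<close>.
\<close>

text \<open>A parallel set is a translate of \<open>H\<close>, and translation by \<open>t\<close>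
  only raises the offset by \<open>a \<bullet> t\<close>. Hence one normal \<open>a\<close> serves
  \<open>H\<close> and all its parallels at once.\<close>

lemma hyperplane_parallelE:
  fixes H :: "(real ^ 'n) set"
  assumes "hyperplane H"
  obtains a b where "a \<noteq> 0" "H = {x. a \<bullet> x = b}"
    "\<And>K. affine_parallel H K \<Longrightarrow> \<exists>c. K = {x. a \<bullet> x = c}"
proof -
  \<comment> \<open>The subtraction is now one of naturals; it does not truncate because
    \<open>CARD('n)\<close> is positive.\<close>
  have "affine hull H = H" and "aff_dim H = int (DIM(real ^ 'n) - 1)"
    using assms by (simp_all add: hyperplane_def affine_hull_eq of_nat_diff Suc_leI)
  then obtain a b where ab: "a \<noteq> 0" "H = {x. a \<bullet> x = b}"
    using aff_dim_eq_hyperplane[of H] by metis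
  have "\<exists>c. K = {x. a \<bullet> x = c}" if "affine_parallel H K" for K
  proof -
    obtain t where t: "K = (\<lambda>x. t + x) ` H"
      using \<open>affine_parallel H K\<close> by (auto simp: affine_parallel_def)
    have "K = {x. a \<bullet> x = b + a \<bullet> t}"
    proof (intro set_eqI iffI)
      fix x assume "x \<in> {x. a \<bullet> x = b + a \<bullet> t}"
      then have "x - t \<in> H" using ab by (simp add: inner_diff_right)
      then show "x \<in> K" unfolding t by (metis add.commute diff_add_cancel image_eqI)
    qed (auto simp: t ab inner_add_right)
    then show ?thesis by blast
  qed
  then show thesis using that ab by blast
qed

text \<open>The normal comes from a member \<open>H\<close> through \<open>s\<close>, so the value
  on \<open>H\<close> is \<open>a \<bullet> s\<close>. At most one other member remains, and being
  parallel to \<open>H\<close> it is a level set of the same functional.\<close>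

lemma covered_by_two_parallel_hyperplanesE:
  fixes S :: "(real ^ 'n) set"
  assumes "covered_by_parallel_hyperplanes S \<H>" "finite \<H>" "card \<H> < 3" "s \<in> S"
  obtains a c where "a \<noteq> 0" "\<And>x. x \<in> S \<Longrightarrow> a \<bullet> x = a \<bullet> s \<or> a \<bullet> x = c"
proof -
  obtain H where H: "H \<in> \<H>" "s \<in> H" "hyperplane H"
    using assms by (auto simp: covered_by_parallel_hyperplanes_def)
  obtain a b where ab: "a \<noteq> 0" "H = {x. a \<bullet> x = b}"
    and par: "\<And>K. affine_parallel H K \<Longrightarrow> \<exists>c. K = {x. a \<bullet> x = c}"
    using hyperplane_parallelE[OF H(3)] by blast
  have "card (\<H> - {H}) \<le> Suc 0"
    using assms H(1) by simp
  then have one: "\<And>K L. K \<in> \<H> - {H} \<Longrightarrow> L \<in> \<H> - {H} \<Longrightarrow> K = L"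
    using assms(2) by (metis card_le_Suc0_iff_eq finite_Diff)
  have "\<exists>c. \<forall>K \<in> \<H> - {H}. K = {x. a \<bullet> x = c}"
  proof (cases "\<H> - {H} = {}")
    case False
    then obtain K where K: "K \<in> \<H> - {H}" by blast
    then have "affine_parallel H K"
      using assms(1) H(1) by (auto simp: covered_by_parallel_hyperplanes_def pairwise_def)
    then show ?thesis using par one K by metis
  \<comment> \<open>If \<open>H\<close> is the only member, any \<open>c\<close> will do.\<close>
  qed auto
  then obtain c where c: "\<And>K. K \<in> \<H> - {H} \<Longrightarrow> K = {x. a \<bullet> x = c}" by blast
  have "a \<bullet> x = a \<bullet> s \<or> a \<bullet> x = c" if "x \<in> S" for x
  proof -
    obtain K where "K \<in> \<H>" "x \<in> K"
      using assms(1) \<open>x \<in> S\<close> by (auto simp: covered_by_parallel_hyperplanes_def)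
    then show ?thesis using ab(2) H(2) c[of K] by (cases "K = H") auto
  qed
  then show thesis using that ab(1) by blast
qed

lemma mem_integer_cube_1I:
  fixes x :: "real ^ 'n"
  assumes "\<And>i. x $ i \<in> {-1, 0, 1}"
  shows "x \<in> integer_cube 1"
proof -
  have "infnorm x \<le> 1"
    unfolding infnorm_cart
  proof (rule cSup_least)
    have "\<bar>x $ i\<bar> \<le> 1" for i
      using assms[of i] by auto
    then show "y \<le> 1" if "y \<in> {\<bar>x $ i\<bar> |i. i \<in> UNIV}" for y
      using that by blast
  qed auto
  moreover have "x $ i \<in> \<int>" for i
    using assms[of i] by auto
  ultimately show ?thesis by (simp add: integer_cube_def)
qed

text \<open>Since \<open>vec 1\<close> is the all-ones vector, the nonzero points sum to
  \<open>0\<close>, so the origin is their centroid.\<close>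

definition centred_simplex :: "(real ^ 'n) set" where
  "centred_simplex = insert 0 (insert (- vec 1) (range (\<lambda>i. axis i 1)))"

lemma centred_simplex_subset: "(centred_simplex :: (real ^ 'n) set) \<subseteq> integer_cube 1"
proof -
  have "axis i 1 \<in> integer_cube 1" for i :: 'n
    by (rule mem_integer_cube_1I) (simp add: axis_def)
  moreover have "0 \<in> integer_cube 1" "- vec 1 \<in> integer_cube 1"
    by (rule mem_integer_cube_1I, simp)+
  ultimately show ?thesis by (auto simp: centred_simplex_def)
qed

lemma card_centred_simplex: "card (centred_simplex :: (real ^ 'n) set) = CARD('n) + 2"
proof -
  let ?A = "range (\<lambda>i. axis i 1) :: (real ^ 'n) set"
  have "inj (\<lambda>i::'n. axis i (1::real))"
    by (auto simp: inj_on_def axis_eq_axis)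
  then have "card ?A = CARD('n)" by (rule card_image)
  moreover have "- vec 1 \<notin> ?A"
  proof
    assume "- vec 1 \<in> ?A"
    then obtain i :: 'n where "- vec 1 = (axis i 1 :: real ^ 'n)" by blast
    \<comment> \<open>Coordinate \<open>i\<close> itself gives -1 = 1; this choice also works in
      dimension one, where there is no other coordinate.\<close>
    then have "(- vec 1 :: real ^ 'n) $ i = axis i 1 $ i" by simp
    then show False by simp
  qed
  moreover have "x \<noteq> 0" if "x \<in> insert (- vec 1) ?A" for x
    using that
  proof (elim insertE rangeE)
    show "x \<noteq> 0" if "x = - vec 1" using that by (simp add: vec_eq_iff)
    show "x \<noteq> 0" if "x = axis i 1" for i using that by simp
  qed
  then have "0 \<notin> insert (- vec 1) ?A" by blast
  ultimately show ?thesis by (simp add: centred_simplex_def)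
qed

lemma two_valued_on_centred_simplex:
  fixes a :: "real ^ 'n"
  assumes "\<And>x. x \<in> centred_simplex \<Longrightarrow> a \<bullet> x = 0 \<or> a \<bullet> x = c"
  shows "a = 0"
proof -
  \<comment> \<open>Counting nonzero entries, rather than those equal to \<open>c\<close>, stays
    meaningful when \<open>c = 0\<close>, and \<open>k = 0\<close> says directly that
    \<open>a = 0\<close>.\<close>
  define k where "k = card {i. a $ i \<noteq> 0}"
  have coord: "a $ i = 0 \<or> a $ i = c" for i
    using assms[of "axis i 1"] by (auto simp: centred_simplex_def inner_axis)
  have "a \<bullet> - vec 1 = - (\<Sum>i\<in>UNIV. a $ i)"
    by (simp add: inner_vec_def sum_negf)
  also have "(\<Sum>i\<in>UNIV. a $ i) = (\<Sum>i\<in>{i. a $ i \<noteq> 0}. a $ i)"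
    by (rule sum.mono_neutral_right) auto
  also have "\<dots> = (\<Sum>i\<in>{i. a $ i \<noteq> 0}. c)"
    using coord by (intro sum.cong) auto
  also have "\<dots> = real k * c" by (simp add: k_def)
  finally have "- (real k * c) = 0 \<or> - (real k * c) = c"
    using assms[of "- vec 1"] by (auto simp: centred_simplex_def)
  then have "real k * c = 0 \<or> (real k + 1) * c = 0"
    by (auto simp: algebra_simps)
  \<comment> \<open>The factor \<open>real k + 1\<close> is positive, so the second alternative
    forces \<open>c = 0\<close>.\<close>
  then have "k = 0 \<or> c = 0"
    by (auto simp: add_eq_0_iff)
  then show ?thesis
    using coord by (auto simp: k_def vec_eq_iff)
qed

theorem proposition2p2:
  "\<exists>S :: (real ^ 'n) set. S \<subseteq> integer_cube 1 \<and> card S = CARD('n) + 2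
     \<and> not_covered_by_fewer_than 3 S"
proof (intro exI conjI)
  show "not_covered_by_fewer_than 3 (centred_simplex :: (real ^ 'n) set)"
    unfolding not_covered_by_fewer_than_def
  proof (intro notI, elim exE conjE)
    fix \<H> :: "(real ^ 'n) set set"
    assume \<H>: "finite \<H>" "card \<H> < 3" "covered_by_parallel_hyperplanes centred_simplex \<H>"
    obtain a :: "real ^ 'n" and c where "a \<noteq> 0"
      and "\<And>x. x \<in> centred_simplex \<Longrightarrow> a \<bullet> x = a \<bullet> 0 \<or> a \<bullet> x = c"
      \<comment> \<open>Taking the origin as base point makes one of the two values
        \<open>a \<bullet> 0 = 0\<close>.\<close>
      using covered_by_two_parallel_hyperplanesE[OF \<H>(3,1,2), of 0]
      by (auto simp: centred_simplex_def)
    then show False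
      using two_valued_on_centred_simplex[of a c] by simp
  qed
qed (rule centred_simplex_subset card_centred_simplex)+

end
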